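(* Let $r>1$ be an integer and let $G$ be a finite, simple, connected, undirected graph. (1) If $G$ contains no induced subgraph isomorphic to a triangle $K_3$ and no induced subgraph isomorphic to $K_{1,r}$, then for any finite, simple, connected, undirected graph $H$, $\gamma(G\square H)\geq \frac{r}{2r-1}\gamma(G)\gamma(H)$. (2) If $G$ contains no induced subgraph isomorphic to $K_r$ and no induced subgraph isomorphic to $P_5$, then for any finite, simple, connected, undirected graph $H$, $\gamma(G\square H)\geq \frac{r-1}{2r-3}\gamma(G)\gamma(H)$.
   Context: $P_n$ denotes the path on $n$ vertices, $K_n$ the complete graph on $n$ vertices, and $K_{1,r}$ the star with $r$ leaves. The domination number $\gamma(G)$ is the minimum cardinality of a set $S\subseteq V(G)$ such that every vertex of $G$ lies in $S$ or is adjacent to a vertex of $S$. The Cartesian product $G\square H$ has vertex set $V(G)\times V(H)$, with $(u_1,v_1)$ and $(u_2,v_2)$ adjacent if and only if either $v_1=v_2$ and $u_1u_2\in E(G)$, or $u_1=u_2$ and $v_1v_2\in E(H)$. *)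

theory Defs
  imports Complex_Main "Graph_Theory.Graph_Theory"
begin

text \<open>
  A finite simple undirected graph is a \<^locale>\<open>pair_graph\<close>: a finite vertex set with a finite,
  symmetric, irreflexive relation on it as arc set. The predicate
  \<^const>\<open>Digraph_Component.connected\<close> requires at least one vertex.
\<close>

definition complete_graph :: "nat \<Rightarrow> nat pair_pre_digraph" where
  "complete_graph n = \<lparr> pverts = {..<n}, parcs = {(i, j). i < n \<and> j < n \<and> i \<noteq> j} \<rparr>"

text \<open>The star with centre \<open>0\<close> and leaves \<open>1, \<dots>, r\<close>.\<close>

definition star_graph :: "nat \<Rightarrow> nat pair_pre_digraph" where
  "star_graph r = \<lparr> pverts = {..r}, parcs = {0} \<times> {1..r} \<union> {1..r} \<times> {0} \<rparr>"

definition path_graph :: "nat \<Rightarrow> nat pair_pre_digraph" where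
  "path_graph n =
    \<lparr> pverts = {..<n}, parcs = {(i, j). i < n \<and> j < n \<and> (j = Suc i \<or> i = Suc j)} \<rparr>"

definition has_induced :: "('a, 'b) pre_digraph \<Rightarrow> ('c, 'd) pre_digraph \<Rightarrow> bool" where
  "has_induced G F \<longleftrightarrow> (\<exists>S. induced_subgraph S G \<and> digraph_iso S F)"

definition dominating_set :: "('a, 'b) pre_digraph \<Rightarrow> 'a set \<Rightarrow> bool" where
  "dominating_set G S \<longleftrightarrow>
    S \<subseteq> verts G \<and> (\<forall>v \<in> verts G. v \<in> S \<or> (\<exists>u \<in> S. u \<rightarrow>\<^bsub>G\<^esub> v))"

definition domination_number :: "('a, 'b) pre_digraph \<Rightarrow> nat" (\<open>\<gamma>\<close>) where
  "\<gamma> G = (LEAST k. \<exists>S. dominating_set G S \<and> card S = k)"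

definition cartesian_product ::
    "'a pair_pre_digraph \<Rightarrow> 'b pair_pre_digraph \<Rightarrow> ('a \<times> 'b) pair_pre_digraph"
    (infixl \<open>\<box>\<close> 70) where
  "G \<box> H =
    \<lparr> pverts = pverts G \<times> pverts H,
      parcs = {((u1, v1), (u2, v2)).
        (v1 = v2 \<and> v1 \<in> pverts H \<and> (u1, u2) \<in> parcs G) \<or>
        (u1 = u2 \<and> u1 \<in> pverts G \<and> (v1, v2) \<in> parcs H)} \<rparr>"

lemma complete_digraph_complete_graph: "complete_digraph n (with_proj (complete_graph n))"
  by (auto simp: complete_digraph_pair_def complete_graph_def)

lemma complete_bipartite_digraph_star_graph:
  "complete_bipartite_digraph 1 r (with_proj (star_graph r))"
proof -
  have "{..r} = {0} \<union> {1..r}" "{0} \<inter> {1..r} = {}" "card {0::nat} = 1" "card {1..r} = r"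
    by auto
  then show ?thesis
    unfolding complete_bipartite_digraph_pair_def star_graph_def pair_pre_digraph.simps
    by blast
qed

lemma pair_graph_path_graph: "pair_graph (path_graph n)"
proof -
  have "finite {(i, j). i < n \<and> j < n \<and> (j = Suc i \<or> i = Suc j)}"
    by (rule finite_subset[of _ "{..<n} \<times> {..<n}"]) auto
  then show ?thesis
    by unfold_locales (auto simp: path_graph_def symmetric_def intro: symI)
qed

lemma pair_graph_cartesian_product:
  assumes "pair_graph G" "pair_graph H"
  shows "pair_graph (G \<box> H)"
proof -
  interpret G: pair_graph G by fact
  interpret H: pair_graph H by fact
  have sub: "parcs (G \<box> H) \<subseteq> (pverts G \<times> pverts H) \<times> (pverts G \<times> pverts H)"
    by (auto simp: cartesian_product_def dest: G.in_arcsD1 G.in_arcsD2 H.in_arcsD1 H.in_arcsD2)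
  then have fin: "finite (parcs (G \<box> H))"
    by (rule finite_subset) (simp add: G.pair_finite_verts H.pair_finite_verts)
  have sG: "sym (parcs G)" and sH: "sym (parcs H)"
    using G.pair_sym_arcs H.pair_sym_arcs by (auto simp: symmetric_def)
  have "sym (parcs (G \<box> H))"
    by (rule symI) (auto simp: cartesian_product_def dest: symD[OF sG] symD[OF sH])
  moreover have "pverts (G \<box> H) = pverts G \<times> pverts H"
    by (simp add: cartesian_product_def)
  moreover have "fst e \<noteq> snd e" if "e \<in> parcs (G \<box> H)" for e
    using that G.pair_no_loops H.pair_no_loops by (force simp: cartesian_product_def)
  ultimately show ?thesis
    using sub fin G.pair_finite_verts H.pair_finite_verts
    by unfold_locales (auto simp: symmetric_def)
qed

end

theory Submission
  imports Defs "HOL-Library.FuncSet"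
begin

text \<open>
  Let \<open>D\<close> be a minimum dominating set of \<open>G\<close> such that every closed neighbourhood meets \<open>D\<close> in at
  most \<open>p\<close> vertices, and let \<open>S\<close> be a minimum dominating set of \<open>G \<box> H\<close>. Label each \<open>(v, h) \<in> S\<close>
  by a uniformly random element of \<open>D\<close> dominating \<open>v\<close>, where a \<open>v\<close> in \<open>D\<close> is labelled by itself. For
  \<open>i \<in> D\<close>, the layers containing the label \<open>i\<close>, together with the layers in which \<open>i\<close> is missing from
  the closed \<open>H\<close>-neighbourhood, form a dominating set of \<open>H\<close>. Minimality of \<open>D\<close> shows that the expected
  number of labels missing at \<open>h\<close> is at most \<open>1 - 1/p\<close> times the number of elements of \<open>S\<close> over \<open>h\<close>;
  summing over \<open>i\<close> gives \<open>\<gamma> G * \<gamma> H \<le> (2 - 1/p) * \<gamma> (G \<box> H)\<close>.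

  In part (1) every closed neighbourhood has at most \<open>r\<close> vertices, so \<open>p = r\<close> works. In part (2), \<open>G\<close> has a
  dominating clique or a dominating set \<open>{w, v, x}\<close> with \<open>w\<close> adjacent to \<open>v\<close>, so \<open>\<gamma> G \<le> r - 1\<close> and
  \<open>p = r - 1\<close> works, except when \<open>r = \<gamma> G = 3\<close>. There \<open>p = 2\<close> may be unattainable (blow up each vertex
  of the 5-cycle into three), and the bound follows instead from
  \<open>\<gamma> (G \<box> H) \<ge> 2 * \<gamma> H\<close>, valid whenever \<open>\<gamma> G \<ge> 2\<close>.
\<close>

section \<open>Domination and induced subgraphs\<close>

text \<open>\<open>has_induced\<close> asks for an isomorphism from the induced subgraph onto
  \<open>F\<close>, so the witness is the inverse of the embedding \<open>f\<close>, acting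
  componentwise on arcs.\<close>

lemma has_inducedI:
  fixes G :: "'a pair_pre_digraph" and F :: "'b pair_pre_digraph"
  assumes "pair_wf_digraph G" and F: "pair_wf_digraph F"
    and f: "inj_on f (pverts F)" "f ` pverts F \<subseteq> pverts G"
    and arcs: "\<And>i j. \<lbrakk>i \<in> pverts F; j \<in> pverts F\<rbrakk> \<Longrightarrow> (f i, f j) \<in> parcs G \<longleftrightarrow> (i, j) \<in> parcs F"
  shows "has_induced G F"
proof -
  interpret pair_wf_digraph G by fact
  interpret F: pair_wf_digraph F by fact
  let ?V = "f ` pverts F"
  let ?g = "the_inv_into (pverts F) f"
  let ?S = "with_proj G \<restriction> ?V"
  let ?iso = "\<lparr>iso_verts = ?g, iso_arcs = map_prod ?g ?g, iso_head = snd, iso_tail = fst\<rparr>"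
  have inv: "?g (f i) = i" if "i \<in> pverts F" for i
    using f(1) that by (rule the_inv_into_f_f)
  have arcs_S: "arcs ?S = map_prod f f ` parcs F"
  proof -
    have "arcs ?S = {(u, v). (u, v) \<in> parcs G \<and> u \<in> ?V \<and> v \<in> ?V}"
      by auto
    also have "\<dots> = map_prod f f ` parcs F"
    proof (intro set_eqI iffI)
      fix e assume "e \<in> {(u, v). (u, v) \<in> parcs G \<and> u \<in> ?V \<and> v \<in> ?V}"
      then obtain i j where "e = map_prod f f (i, j)" "i \<in> pverts F" "j \<in> pverts F" "(f i, f j) \<in> parcs G"
        by auto
      then show "e \<in> map_prod f f ` parcs F"
        using arcs by blast
    next
      fix e assume "e \<in> map_prod f f ` parcs F"
      then obtain i j where ij: "e = (f i, f j)" "(i, j) \<in> parcs F"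
        by auto
      then show "e \<in> {(u, v). (u, v) \<in> parcs G \<and> u \<in> ?V \<and> v \<in> ?V}"
        using arcs F.in_arcsD1 F.in_arcsD2 by blast
    qed
    finally show ?thesis .
  qed
  have ind: "induced_subgraph ?S (with_proj G)"
    using f(2) by (intro induced_induce) auto
  have inj_g: "inj_on ?g ?V"
    using f(1) by (rule inj_on_the_inv_into)
  have "arcs ?S \<subseteq> ?V \<times> ?V"
    by auto
  then have "pre_digraph.digraph_isomorphism ?S ?iso"
    using ind inj_g map_prod_inj_on[OF inj_g inj_g]
    unfolding pre_digraph.digraph_isomorphism_def
    by (auto simp: induced_subgraph_def subgraph_def intro: inj_on_subset)
  moreover have "with_proj F = app_iso ?iso ?S"
  proof -
    have "?g ` ?V = pverts F"
      by (auto simp: inv image_iff)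
    moreover have "map_prod ?g ?g ` arcs ?S = parcs F"
    proof -
      have "map_prod ?g ?g (map_prod f f e) = e" if "e \<in> parcs F" for e
        using that by (cases e) (simp add: inv F.in_arcsD1 F.in_arcsD2)
      then show ?thesis
        unfolding arcs_S image_image by simp
    qed
    ultimately show ?thesis
      by (simp add: app_iso_def with_proj_def)
  qed
  ultimately show ?thesis
    unfolding has_induced_def digraph_iso_def using ind by blast
qed

definition covers :: "'a pair_pre_digraph \<Rightarrow> 'a \<Rightarrow> 'a \<Rightarrow> bool" where
  "covers G u v \<longleftrightarrow> u = v \<or> (u, v) \<in> parcs G"

lemma (in pair_sym_digraph) covers_sym: "covers G u v \<Longrightarrow> covers G v u"
  using arcs_symmetric by (auto simp: covers_def)

lemma covers_refl [simp]: "covers G v v"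
  by (simp add: covers_def)

lemma dominating_set_iff:
  "dominating_set (with_proj G) S \<longleftrightarrow> S \<subseteq> pverts G \<and> (\<forall>v \<in> pverts G. \<exists>u \<in> S. covers G u v)"
  by (auto simp: dominating_set_def covers_def)

lemma domination_number_le: "dominating_set G S \<Longrightarrow> \<gamma> G \<le> card S"
  unfolding domination_number_def by (rule Least_le) blast

lemma obtain_minimum_dominating_set:
  obtains S where "dominating_set G S" "card S = \<gamma> G"
proof -
  have "dominating_set G (verts G)"
    by (simp add: dominating_set_def)
  then have "\<exists>k S. dominating_set G S \<and> card S = k"
    by blast
  then show ?thesis
    using that LeastI_ex[of "\<lambda>k. \<exists>S. dominating_set G S \<and> card S = k"]
    unfolding domination_number_def by blast
qed

lemma dominating_set_cartesian_product:
  "dominating_set (with_proj (G \<box> H)) S \<longleftrightarrow> S \<subseteq> pverts G \<times> pverts H \<and>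
    (\<forall>v \<in> pverts G. \<forall>h \<in> pverts H.
      (\<exists>u. (u, h) \<in> S \<and> covers G u v) \<or> (\<exists>h'. (v, h') \<in> S \<and> (h', h) \<in> parcs H))"
  unfolding dominating_set_iff
  by (fastforce simp: cartesian_product_def covers_def)

section \<open>Random labellings\<close>

lemma finite_dominating_set:
  "pair_graph G \<Longrightarrow> dominating_set G S \<Longrightarrow> finite S"
  by (meson dominating_set_iff finite_subset pair_graph_def pair_digraph_def pair_fin_digraph.pair_finite_verts)

lemma sum_card_swap:
  assumes "finite A" "finite B"
  shows "(\<Sum>a\<in>A. card {b \<in> B. R a b}) = (\<Sum>b\<in>B. card {a \<in> A. R a b})"
  using assms by (intro sum_multicount_gen) auto

text \<open>Here \<open>Suc q\<close> plays the role of \<open>p\<close>, which keeps subtraction of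
  natural numbers out of the bounds.\<close>

locale labelled_product =
  fixes G :: "'a pair_pre_digraph" and H :: "'b pair_pre_digraph"
    and D :: "'a set" and S :: "('a \<times> 'b) set" and q :: nat
  assumes G: "pair_graph G" and H: "pair_graph H"
    and D: "dominating_set G D" and card_D: "card D = \<gamma> G"
    and S: "dominating_set (G \<box> H) S"
    and allegiance: "v \<in> pverts G \<Longrightarrow> card {u \<in> D. covers G u v} \<le> Suc q"
begin

sublocale G: pair_graph G by (rule G)
sublocale H: pair_graph H by (rule H)

lemma finite_D: "finite D"
  using G D by (rule finite_dominating_set)

lemma finite_S: "finite S"
  using pair_graph_cartesian_product[OF G H] S by (rule finite_dominating_set)

lemma D_subset: "D \<subseteq> pverts G" and S_subset: "S \<subseteq> pverts G \<times> pverts H"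
  using D S by (simp_all add: dominating_set_iff[of G] dominating_set_cartesian_product)

definition allowed :: "'a \<times> 'b \<Rightarrow> 'a set" where
  "allowed s = (if fst s \<in> D then {fst s} else {u \<in> D. covers G u (fst s)})"

definition labellings :: "('a \<times> 'b \<Rightarrow> 'a) set" where
  "labellings = PiE S allowed"

definition slice :: "'b \<Rightarrow> 'a set" where
  "slice h = {v. (v, h) \<in> S}"

definition labels :: "('a \<times> 'b \<Rightarrow> 'a) \<Rightarrow> 'b \<Rightarrow> 'a set" where
  "labels l h = (\<lambda>v. l (v, h)) ` slice h"

text \<open>Only layers over neighbours of \<open>h\<close> are inspected, never \<open>h\<close>
  itself, so the set is independent of the labels chosen over \<open>h\<close>. A label absent from
  the whole closed neighbourhood lies in \<open>unseen l h - labels l h\<close>.\<close>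

definition unseen :: "('a \<times> 'b \<Rightarrow> 'a) \<Rightarrow> 'b \<Rightarrow> 'a set" where
  "unseen l h = {i \<in> D. \<forall>(v, h') \<in> S. (h', h) \<in> parcs H \<longrightarrow> l (v, h') \<noteq> i}"

lemma finite_slice: "finite (slice h)"
proof -
  have "slice h \<subseteq> fst ` S"
    by (force simp: slice_def)
  then show ?thesis
    using finite_S finite_subset by blast
qed

lemma finite_labellings: "finite labellings"
  unfolding labellings_def using finite_S finite_D
  by (intro finite_PiE) (auto simp: allowed_def)

lemma allowed_nonempty: "s \<in> S \<Longrightarrow> allowed s \<noteq> {}"
proof -
  assume "s \<in> S"
  then have "fst s \<in> pverts G"
    using S_subset by auto
  then show ?thesis
    using D by (auto simp: allowed_def dominating_set_iff)
qed

lemma labellings_nonempty: "labellings \<noteq> {}"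
  unfolding labellings_def PiE_eq_empty_iff using allowed_nonempty by auto

lemma label_allowed: "l \<in> labellings \<Longrightarrow> s \<in> S \<Longrightarrow> l s \<in> allowed s"
  unfolding labellings_def by (rule PiE_mem)

lemma allowed_covers: "i \<in> allowed s \<Longrightarrow> covers G i (fst s) \<and> i \<in> D"
  by (auto simp: allowed_def covers_def split: if_splits)

section \<open>Unseen labels over a single layer\<close>

lemma dominating_slice:
  assumes l: "l \<in> labellings" and h: "h \<in> pverts H"
  shows "dominating_set G (slice h \<union> (D - unseen l h))"
  unfolding dominating_set_iff
proof (intro conjI ballI)
  show "slice h \<union> (D - unseen l h) \<subseteq> pverts G"
    using D_subset S_subset by (auto simp: slice_def)
next
  fix v assume v: "v \<in> pverts G"
  consider u where "(u, h) \<in> S" "covers G u v" | h' where "(v, h') \<in> S" "(h', h) \<in> parcs H"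
    using S v h unfolding dominating_set_cartesian_product by blast
  then show "\<exists>u \<in> slice h \<union> (D - unseen l h). covers G u v"
  proof cases
    case 1
    then show ?thesis by (auto simp: slice_def)
  next
    \<comment> \<open>The vertex \<open>(v, h')\<close> of an adjacent layer is replaced by its
      label, which covers \<open>v\<close> and is seen from \<open>h\<close>.\<close>
    case 2
    then have "l (v, h') \<in> D - unseen l h" "covers G (l (v, h')) v"
      using allowed_covers[OF label_allowed[OF l 2(1)]] by (auto simp: unseen_def)
    then show ?thesis by blast
  qed
qed

text \<open>As \<open>D\<close> is minimum, the dominating set of \<open>dominating_slice\<close>
  has at least \<open>card D\<close> elements. Counting its union gives the bound, arranged without
  subtraction.\<close>

lemma card_unseen:
  assumes l: "l \<in> labellings" and h: "h \<in> pverts H"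
  shows "card (unseen l h) + card (slice h \<inter> D) \<le> card (slice h) + card {i \<in> slice h \<inter> D. i \<in> unseen l h}"
proof -
  let ?B = "unseen l h" and ?U = "slice h \<inter> D"
  note fin = finite_slice[of h] finite_D
  have B: "?B \<subseteq> D"
    by (auto simp: unseen_def)
  have "card D \<le> card (slice h \<union> (D - ?B))"
    using domination_number_le[OF dominating_slice[OF l h]] by (simp add: card_D)
  moreover have "card (slice h) + card (D - ?B) = card (slice h \<union> (D - ?B)) + card (?U - ?B)"
    using card_Un_Int[of "slice h" "D - ?B"] fin by (simp add: Int_Diff)
  moreover have "card D = card ?B + card (D - ?B)"
    using B fin by (metis card_Diff_subset card_mono finite_subset le_add_diff_inverse)
  moreover have "card ?U = card (?U \<inter> ?B) + card (?U - ?B)"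
    using fin by (metis card_Diff_subset_Int card_mono finite_Int inf_le1 le_add_diff_inverse)
  moreover have "?U \<inter> ?B = {i \<in> ?U. i \<in> ?B}"
    by blast
  ultimately show ?thesis
    by simp
qed

text \<open>Something in \<open>S\<close> dominates \<open>(i, h)\<close>. In an adjacent layer this
  could only be some \<open>(i, h')\<close>, which is labelled \<open>i\<close> because elements of
  \<open>D\<close> label themselves, and then \<open>i\<close> would be seen. So the dominator lies
  over \<open>h\<close>, and the cases sort it.\<close>

lemma unseen_cases:
  assumes l: "l \<in> labellings" and h: "h \<in> pverts H" and i: "i \<in> unseen l h"
  obtains "i \<in> slice h" | u where "u \<in> slice h \<inter> D" "(u, i) \<in> parcs G"
    | v where "v \<in> slice h - D" "covers G i v"
proof -
  have iD: "i \<in> D" "i \<in> pverts G"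
    using i D_subset by (auto simp: unseen_def)
  consider u where "(u, h) \<in> S" "covers G u i" | h' where "(i, h') \<in> S" "(h', h) \<in> parcs H"
    using S iD(2) h unfolding dominating_set_cartesian_product by blast
  then show thesis
  proof cases
    case 1
    then show thesis
      using that G.arcs_symmetric[of u i] by (auto simp: slice_def covers_def)
  next
    case 2
    then have "l (i, h') = i"
      using label_allowed[OF l 2(1)] iD by (simp add: allowed_def)
    then show thesis
      using i 2 by (auto simp: unseen_def)
  qed
qed

text \<open>Relabelling one vertex of the layer over \<open>h\<close> does not affect \<open>unseen l h\<close>, so a label in
  \<open>unseen l h\<close> is attained there by at least a fraction \<open>1 / Suc q\<close> of the labellings.\<close>

lemma card_unseen_labelled:
  assumes v: "(v, h) \<in> S" "v \<notin> D" and i: "i \<in> D" "covers G i v"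
  shows "card {l \<in> labellings. i \<in> unseen l h}
    \<le> Suc q * card {l \<in> labellings. i \<in> unseen l h \<and> i \<in> labels l h}"
proof -
  let ?A = "{l \<in> labellings. i \<in> unseen l h}"
  let ?B = "{l \<in> labellings. i \<in> unseen l h \<and> i \<in> labels l h}"
  \<comment> \<open>Recording the old label makes the relabelling injective; at most
    \<open>Suc q\<close> old labels are possible.\<close>
  let ?f = "\<lambda>l. (l (v, h), l((v, h) := i))"
  have al: "allowed (v, h) = {u \<in> D. covers G u v}"
    using v by (simp add: allowed_def)
  have "inj_on ?f ?A"
  proof (rule inj_onI)
    fix l l' assume "?f l = ?f l'"
    then show "l = l'"
      by (metis (no_types, lifting) fun_upd_triv fun_upd_upd prod.inject)
  qed
  moreover have "?f ` ?A \<subseteq> allowed (v, h) \<times> ?B"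
  proof (intro subsetI, elim imageE CollectE conjE)
    fix x l assume x: "x = ?f l" and l: "l \<in> labellings" and un: "i \<in> unseen l h"
    have "l((v, h) := i) \<in> labellings"
      using l v i unfolding labellings_def al PiE_def Pi_def extensional_def by (auto simp: al)
    moreover have "i \<in> unseen (l((v, h) := i)) h"
      using un H.no_loops' by (fastforce simp: unseen_def)
    moreover have "i \<in> labels (l((v, h) := i)) h"
      using v by (force simp: labels_def slice_def)
    ultimately show "x \<in> allowed (v, h) \<times> ?B"
      using x label_allowed[OF l v(1)] by simp
  qed
  moreover have "finite (allowed (v, h) \<times> ?B)"
    using finite_D finite_labellings by (simp add: al)
  ultimately have "card ?A \<le> card (allowed (v, h) \<times> ?B)"
    by (rule card_inj_on_le)
  also have "\<dots> \<le> Suc q * card ?B"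
    unfolding card_cartesian_product al using allegiance[of v] v S_subset by (intro mult_right_mono) auto
  finally show ?thesis .
qed

text \<open>Elements of \<open>U\<close> label themselves and are never missing. An element of
  \<open>Z\<close> is missing in at most a fraction q/(q+1) of the labellings that leave it unseen,
  by \<open>card_unseen_labelled\<close>. Elements of \<open>Y\<close> may always be missing, but
  there are at most q of them per element of \<open>U\<close>, and the term \<open>card U\<close>
  gained in \<open>card_unseen\<close> pays for them.\<close>

lemma sum_card_missing:
  assumes h: "h \<in> pverts H"
  shows "Suc q * (\<Sum>l\<in>labellings. card (unseen l h - labels l h)) \<le> q * (card labellings * card (slice h))"
proof -
  define U where "U = slice h \<inter> D"
  define Y where "Y = {i \<in> D - U. \<exists>u \<in> U. (u, i) \<in> parcs G}"
  define Z where "Z = {i \<in> D - U - Y. \<exists>v \<in> slice h - D. covers G i v}"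
  define b where "b = (\<lambda>A. \<Sum>l\<in>labellings. card {i \<in> A. i \<in> unseen l h})"
  define M where "M = (\<Sum>l\<in>labellings. card (unseen l h - labels l h))"
  define C where "C = (\<Sum>l\<in>labellings. card (unseen l h \<inter> labels l h))"
  define c where "c = (\<Sum>l\<in>labellings. card {i \<in> Z. i \<in> unseen l h \<and> i \<in> labels l h})"
  have fin: "finite U" "finite Y" "finite Z"
    using finite_D by (auto simp: U_def Y_def Z_def)
  have un_D: "unseen l h \<subseteq> D" for l
    by (auto simp: unseen_def)
  then have fin_un: "finite (unseen l h)" for l
    using finite_D finite_subset by blast
  have disj: "U \<inter> Y = {}" "U \<inter> Z = {}" "Y \<inter> Z = {}"
    by (auto simp: Y_def Z_def)
  have B: "(\<Sum>l\<in>labellings. card (unseen l h)) = b U + b Y + b Z"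
  proof -
    have "card (unseen l h) = card {i \<in> U. i \<in> unseen l h} + card {i \<in> Y. i \<in> unseen l h}
        + card {i \<in> Z. i \<in> unseen l h}" if l: "l \<in> labellings" for l
    proof -
      have "unseen l h = {i \<in> U. i \<in> unseen l h} \<union> {i \<in> Y. i \<in> unseen l h} \<union> {i \<in> Z. i \<in> unseen l h}"
        using unseen_cases[OF l h] un_D[of l] unfolding U_def Y_def Z_def by blast
      then have "card (unseen l h) = card ({i \<in> U. i \<in> unseen l h} \<union> {i \<in> Y. i \<in> unseen l h} \<union> {i \<in> Z. i \<in> unseen l h})"
        by simp
      also have "\<dots> = card ({i \<in> U. i \<in> unseen l h} \<union> {i \<in> Y. i \<in> unseen l h}) + card {i \<in> Z. i \<in> unseen l h}"
        using fin disj by (intro card_Un_disjoint) auto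
      also have "card ({i \<in> U. i \<in> unseen l h} \<union> {i \<in> Y. i \<in> unseen l h})
          = card {i \<in> U. i \<in> unseen l h} + card {i \<in> Y. i \<in> unseen l h}"
        using fin disj by (intro card_Un_disjoint) auto
      finally show ?thesis .
    qed
    then show ?thesis
      by (simp add: b_def sum.distrib)
  qed
  have B': "(\<Sum>l\<in>labellings. card (unseen l h)) = M + C"
    unfolding M_def C_def sum.distrib[symmetric]
    by (intro sum.cong refl)
      (metis Int_commute add.commute card_Diff_subset_Int card_mono fin_un finite_Int inf_le2
        le_add_diff_inverse)
  have C: "b U + c \<le> C"
    unfolding b_def c_def C_def sum.distrib[symmetric]
  proof (rule sum_mono)
    fix l assume l: "l \<in> labellings"
    have "card {i \<in> U. i \<in> unseen l h} + card {i \<in> Z. i \<in> unseen l h \<and> i \<in> labels l h}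
        = card ({i \<in> U. i \<in> unseen l h} \<union> {i \<in> Z. i \<in> unseen l h \<and> i \<in> labels l h})"
      using fin disj by (intro card_Un_disjoint[symmetric]) auto
    also have "\<dots> \<le> card (unseen l h \<inter> labels l h)"
    proof (rule card_mono)
      have "i \<in> labels l h" if "i \<in> U" for i
      proof -
        have i: "i \<in> slice h" "i \<in> D" "(i, h) \<in> S"
          using that by (auto simp: U_def slice_def)
        then have "l (i, h) = i"
          using label_allowed[OF l i(3)] by (simp add: allowed_def)
        then show ?thesis
          using i(1) unfolding labels_def by force
      qed
      then show "{i \<in> U. i \<in> unseen l h} \<union> {i \<in> Z. i \<in> unseen l h \<and> i \<in> labels l h} \<subseteq> unseen l h \<inter> labels l h"
        by blast
    qed (use fin_un in blast)
    finally show "card {i \<in> U. i \<in> unseen l h} + card {i \<in> Z. i \<in> unseen l h \<and> i \<in> labels l h}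
      \<le> card (unseen l h \<inter> labels l h)" .
  qed
  have Z: "b Z \<le> Suc q * c"
    unfolding b_def c_def sum_card_swap[OF finite_labellings fin(3)] sum_distrib_left
  proof (rule sum_mono)
    fix i assume "i \<in> Z"
    then obtain v where "i \<in> D" "(v, h) \<in> S" "v \<notin> D" "covers G i v"
      by (auto simp: Z_def slice_def)
    then show "card {l \<in> labellings. i \<in> unseen l h}
        \<le> Suc q * card {l \<in> labellings. i \<in> unseen l h \<and> i \<in> labels l h}"
      by (intro card_unseen_labelled)
  qed
  have U: "b U + b Y + b Z + card labellings * card U \<le> card labellings * card (slice h) + b U"
  proof -
    have "(\<Sum>l\<in>labellings. card (unseen l h) + card U)
        \<le> (\<Sum>l\<in>labellings. card (slice h) + card {i \<in> U. i \<in> unseen l h})"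
      using card_unseen[OF _ h] unfolding U_def by (rule sum_mono)
    then show ?thesis
      unfolding sum.distrib B by (simp add: b_def)
  qed
  have Y: "b Y \<le> card labellings * (q * card U)"
  proof -
    have "card Y \<le> card (\<Union>u\<in>U. {i \<in> D. (u, i) \<in> parcs G})"
      using fin(1) finite_D by (intro card_mono) (auto simp: Y_def)
    also have "\<dots> \<le> (\<Sum>u\<in>U. card {i \<in> D. (u, i) \<in> parcs G})"
      using fin(1) by (rule card_UN_le)
    also have "\<dots> \<le> (\<Sum>u\<in>U. q)"
    proof (rule sum_mono)
      fix u assume "u \<in> U"
      then have u: "u \<in> D" "u \<in> pverts G"
        using D_subset by (auto simp: U_def)
      \<comment> \<open>\<open>u\<close> covers itself, which leaves at most \<open>q\<close>
        neighbours of \<open>u\<close> in \<open>D\<close>.\<close>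
      have "{i \<in> D. covers G i u} = insert u {i \<in> D. (u, i) \<in> parcs G}"
        using u(1) G.arcs_symmetric by (auto simp: covers_def)
      moreover have "u \<notin> {i \<in> D. (u, i) \<in> parcs G}"
        using G.no_loops'[of u u] by blast
      ultimately show "card {i \<in> D. (u, i) \<in> parcs G} \<le> q"
        using allegiance[OF u(2)] finite_D by simp
    qed
    finally have "card Y \<le> q * card U"
      by (simp add: mult.commute)
    moreover have "b Y \<le> (\<Sum>l\<in>labellings. card Y)"
      unfolding b_def using fin(2) by (intro sum_mono card_mono) auto
    ultimately have "b Y \<le> card labellings * card Y" "card labellings * card Y \<le> card labellings * (q * card U)"
      by (simp_all only: sum_constant of_nat_id mult_le_mono2)
    then show ?thesis
      by (rule order_trans)
  qed
  have "M + (b U + c) \<le> b U + b Y + b Z"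
    using B B' C by simp
  then have "Suc q * (M + (b U + c)) \<le> Suc q * (b U + b Y + b Z)"
    by (rule mult_le_mono2)
  \<comment> \<open>Subtracting \<open>Suc q * c\<close>, which is at least \<open>b Z\<close>,
    leaves only \<open>q * b Z\<close> of \<open>Suc q * b Z\<close>.\<close>
  then have 1: "Suc q * M \<le> Suc q * b Y + q * b Z"
    using Z by (simp add: algebra_simps)
  have "q * (b Y + b Z + card labellings * card U) \<le> q * (card labellings * card (slice h))"
    using U by (intro mult_le_mono2) simp
  \<comment> \<open>The extra copy of \<open>b Y\<close> is absorbed by the summand
    \<open>q * (card labellings * card U)\<close>.\<close>
  then have "Suc q * b Y + q * b Z \<le> q * (card labellings * card (slice h))"
    using Y by (simp add: algebra_simps)
  with 1 show ?thesis
    unfolding M_def by simp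
qed

section \<open>Averaging over labellings and summing over layers\<close>

lemma sum_card_slice: "(\<Sum>h\<in>pverts H. card (slice h)) = card S"
proof -
  have "S = (\<Union>h\<in>pverts H. slice h \<times> {h})"
    using S_subset by (auto simp: slice_def)
  then have "card S = card (\<Union>h\<in>pverts H. slice h \<times> {h})"
    by simp
  also have "\<dots> = (\<Sum>h\<in>pverts H. card (slice h \<times> {h}))"
    using finite_slice by (intro card_UN_disjoint H.pair_finite_verts) auto
  finally show ?thesis
    by (simp add: card_cartesian_product)
qed

text \<open>An averaging argument: if every labelling violated the bound, summing over the finite
  nonempty set of labellings would contradict \<open>sum_card_missing\<close> added up over all
  layers.\<close>

lemma exists_good_labelling:
  obtains l where "l \<in> labellings"
    "Suc q * (\<Sum>h\<in>pverts H. card (unseen l h - labels l h)) \<le> q * card S"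
proof -
  have "\<exists>l\<in>labellings. Suc q * (\<Sum>h\<in>pverts H. card (unseen l h - labels l h)) \<le> q * card S"
  proof (rule ccontr)
    assume *: "\<not> ?thesis"
    have "card labellings * (q * card S) = (\<Sum>l\<in>labellings. q * card S)"
      by simp
    also have "\<dots> < (\<Sum>l\<in>labellings. Suc q * (\<Sum>h\<in>pverts H. card (unseen l h - labels l h)))"
      using * finite_labellings labellings_nonempty by (intro sum_strict_mono) (auto simp: not_le)
    also have "\<dots> = (\<Sum>h\<in>pverts H. Suc q * (\<Sum>l\<in>labellings. card (unseen l h - labels l h)))"
      unfolding sum_distrib_left by (rule sum.swap)
    also have "\<dots> \<le> (\<Sum>h\<in>pverts H. q * (card labellings * card (slice h)))"
      by (intro sum_mono sum_card_missing)
    also have "\<dots> = card labellings * (q * card S)"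
      unfolding sum_card_slice[symmetric] by (simp add: sum_distrib_left mult.left_commute)
    finally show False
      by simp
  qed
  then show ?thesis
    using that by blast
qed

lemma dominating_set_label:
  assumes "i \<in> D"
  shows "dominating_set H ({h. \<exists>v. (v, h) \<in> S \<and> l (v, h) = i} \<union> {h \<in> pverts H. i \<in> unseen l h - labels l h})"
    (is "dominating_set H (?P \<union> ?Q)")
  unfolding dominating_set_iff
proof (intro conjI ballI)
  show "?P \<union> ?Q \<subseteq> pverts H"
    using S_subset by auto
next
  fix h assume h: "h \<in> pverts H"
  consider "i \<in> labels l h" | "i \<notin> unseen l h" | "h \<in> ?Q"
    using h by blast
  then show "\<exists>u \<in> ?P \<union> ?Q. covers H u h"
  proof cases
    case 1
    then have "h \<in> ?P"
      by (auto simp: labels_def slice_def)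
    then show ?thesis
      by (auto simp: covers_def)
  next
    case 2
    then obtain v h' where "(v, h') \<in> S" "(h', h) \<in> parcs H" "l (v, h') = i"
      using assms by (auto simp: unseen_def)
    then show ?thesis
      by (auto simp: covers_def)
  next
    case 3
    then show ?thesis
      by (auto simp: covers_def)
  qed
qed

text \<open>Add the sizes of the sets in \<open>dominating_set_label\<close> over \<open>i\<close>
  in \<open>D\<close>. Each element of \<open>S\<close> has exactly one label, so the first parts
  contribute at most \<open>card S\<close>; the missing labels contribute at most q/(q+1) times
  that.\<close>

lemma allegiance_bound_card: "Suc q * (\<gamma> G * \<gamma> H) \<le> (2 * q + 1) * card S"
proof -
  obtain l where l: "l \<in> labellings"
    and le: "Suc q * (\<Sum>h\<in>pverts H. card (unseen l h - labels l h)) \<le> q * card S"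
    by (rule exists_good_labelling)
  let ?P = "\<lambda>i. {h. \<exists>v. (v, h) \<in> S \<and> l (v, h) = i}"
  let ?Q = "\<lambda>i. {h \<in> pverts H. i \<in> unseen l h - labels l h}"
  have "\<gamma> H \<le> card {s \<in> S. l s = i} + card (?Q i)" if "i \<in> D" for i
  proof -
    have "\<gamma> H \<le> card (?P i \<union> ?Q i)"
      using that by (intro domination_number_le dominating_set_label)
    also have "\<dots> \<le> card (?P i) + card (?Q i)"
      by (rule card_Un_le)
    also have "?P i = snd ` {s \<in> S. l s = i}"
      by force
    also have "card (snd ` {s \<in> S. l s = i}) \<le> card {s \<in> S. l s = i}"
      using finite_S by (intro card_image_le) simp
    finally show ?thesis
      by simp
  qed
  then have "(\<Sum>i\<in>D. \<gamma> H) \<le> (\<Sum>i\<in>D. card {s \<in> S. l s = i} + card (?Q i))"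
    by (rule sum_mono)
  also have "\<dots> = (\<Sum>s\<in>S. card {i \<in> D. l s = i}) + (\<Sum>h\<in>pverts H. card {i \<in> D. i \<in> unseen l h - labels l h})"
    unfolding sum.distrib
    by (intro arg_cong2[where f = "(+)"] sum_card_swap finite_D finite_S H.pair_finite_verts)
  also have "(\<Sum>s\<in>S. card {i \<in> D. l s = i}) = (\<Sum>s\<in>S. 1)"
  proof (rule sum.cong[OF refl])
    fix s assume "s \<in> S"
    then have "l s \<in> D"
      using label_allowed[OF l] allowed_covers by blast
    then have "{i \<in> D. l s = i} = {l s}"
      by blast
    then show "card {i \<in> D. l s = i} = 1"
      by simp
  qed
  also have "(\<Sum>h\<in>pverts H. card {i \<in> D. i \<in> unseen l h - labels l h})
      = (\<Sum>h\<in>pverts H. card (unseen l h - labels l h))"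
    by (intro sum.cong refl arg_cong[where f = card]) (auto simp: unseen_def)
  finally have "\<gamma> G * \<gamma> H \<le> card S + (\<Sum>h\<in>pverts H. card (unseen l h - labels l h))"
    by (simp add: card_D)
  then have "Suc q * (\<gamma> G * \<gamma> H) \<le> Suc q * (card S + (\<Sum>h\<in>pverts H. card (unseen l h - labels l h)))"
    by (rule mult_le_mono2)
  then show ?thesis
    using le by (simp add: add_mult_distrib2)
qed

end

theorem allegiance_bound:
  fixes G :: "'a pair_pre_digraph" and H :: "'b pair_pre_digraph"
  assumes "pair_graph G" "pair_graph H" "dominating_set G D" "card D = \<gamma> G"
    and "\<And>v. v \<in> pverts G \<Longrightarrow> card {u \<in> D. covers G u v} \<le> Suc q"
  shows "Suc q * (\<gamma> G * \<gamma> H) \<le> (2 * q + 1) * \<gamma> (G \<box> H)"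
proof -
  obtain S where S: "dominating_set (G \<box> H) S" and card_S: "card S = \<gamma> (G \<box> H)"
    by (rule obtain_minimum_dominating_set)
  interpret labelled_product G H D S q
    using assms S by (simp add: labelled_product_def)
  show ?thesis
    using allegiance_bound_card card_S by simp
qed

section \<open>Graphs of domination number at least two\<close>

context pair_graph begin

definition clique :: "'a set \<Rightarrow> bool" where
  "clique K \<longleftrightarrow> K \<subseteq> pverts G \<and> (\<forall>a \<in> K. \<forall>b \<in> K. covers G a b)"

text \<open>\<open>A\<close> is a clique of maximum size. A vertex outside is nonadjacent to some
  member of \<open>A\<close> by maximality. A member of \<open>A\<close> has a non-neighbour because
  no single vertex dominates, and that non-neighbour is outside the clique.\<close>

lemma exists_nonadjacent_partition:
  assumes "2 \<le> \<gamma> G"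
  obtains A B where "A \<union> B = pverts G" "A \<inter> B = {}" "A \<noteq> {}"
    "\<And>a. a \<in> A \<Longrightarrow> \<exists>b \<in> B. \<not> covers G a b" "\<And>b. b \<in> B \<Longrightarrow> \<exists>a \<in> A. \<not> covers G a b"
proof -
  have "clique {}"
    by (simp add: clique_def)
  moreover have "\<forall>A. clique A \<longrightarrow> card A < Suc (card (pverts G))"
    using pair_finite_verts by (simp add: clique_def card_mono less_Suc_eq_le)
  ultimately obtain A where clique: "clique A" and max: "\<And>A'. clique A' \<Longrightarrow> card A' \<le> card A"
    using ex_has_greatest_nat[of clique "{}" card "Suc (card (pverts G))"] by blast
  have A: "A \<subseteq> pverts G" "\<forall>a \<in> A. \<forall>b \<in> A. covers G a b"
    using clique by (simp_all add: clique_def)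
  have fin: "finite A"
    using A pair_finite_verts finite_subset by blast
  have non_universal: "\<exists>b \<in> pverts G. \<not> covers G a b" if "a \<in> pverts G" for a
  proof (rule ccontr)
    assume "\<not> ?thesis"
    then have "dominating_set G {a}"
      using that by (auto simp: dominating_set_iff)
    then show False
      using domination_number_le assms by fastforce
  qed
  have B: "\<exists>a \<in> A. \<not> covers G a b" if b: "b \<in> pverts G - A" for b
  proof (rule ccontr)
    assume "\<not> ?thesis"
    then have "clique (insert b A)"
      using A b covers_sym by (auto simp: clique_def)
    then have "card (insert b A) \<le> card A"
      by (rule max)
    then show False
      using b fin by simp
  qed
  have "pverts G \<noteq> {}"
  proof
    assume "pverts G = {}"
    then have "dominating_set G {}"
      by (simp add: dominating_set_iff)
    then show False
      using domination_number_le assms by fastforce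
  qed
  then have "A \<noteq> {}"
    using B by (cases "A = {}") auto
  moreover have "\<exists>b \<in> pverts G - A. \<not> covers G a b" if "a \<in> A" for a
    using non_universal[of a] A that by blast
  ultimately show ?thesis
    using A B by (intro that[of A "pverts G - A"]) auto
qed

end

text \<open>Over a layer \<open>h\<close> of \<open>U A\<close>, all of \<open>A \<times> {h}\<close> is dominated from \<open>B \<times> {h}\<close>, and one
  vertex does not suffice for that. So \<open>S\<close> has room to pay for both dominating sets \<open>P A \<union> U A\<close> and
  \<open>P B \<union> U B\<close> of \<open>H\<close>.\<close>

theorem domination_number_product_ge_twice:
  fixes G :: "'a pair_pre_digraph" and H :: "'b pair_pre_digraph"
  assumes G: "pair_graph G" and H: "pair_graph H" and "2 \<le> \<gamma> G"
  shows "2 * \<gamma> H \<le> \<gamma> (G \<box> H)"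
proof -
  interpret G: pair_graph G by fact
  interpret H: pair_graph H by fact
  obtain S where S: "dominating_set (G \<box> H) S" and card_S: "card S = \<gamma> (G \<box> H)"
    by (rule obtain_minimum_dominating_set)
  have fin: "finite S"
    using S G.pair_finite_verts H.pair_finite_verts
    by (auto simp: dominating_set_cartesian_product intro: finite_subset)
  obtain A B where part: "A \<union> B = pverts G" "A \<inter> B = {}" "A \<noteq> {}"
    and A: "\<And>a. a \<in> A \<Longrightarrow> \<exists>b \<in> B. \<not> covers G a b" and B: "\<And>b. b \<in> B \<Longrightarrow> \<exists>a \<in> A. \<not> covers G a b"
    using assms(3) by (rule G.exists_nonadjacent_partition) blast
  define layer where "layer = (\<lambda>A h. {(a, h') \<in> S. a \<in> A \<and> h' = h})"
  define P where "P = (\<lambda>A. {h \<in> pverts H. layer A h \<noteq> {}})"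
  define U where "U = (\<lambda>A. {h \<in> pverts H. \<forall>h' \<in> P A. \<not> covers H h' h})"
  have fin_layer: "finite (layer A h)" for A h
    using fin by (auto simp: layer_def intro: finite_subset)
  have two: "2 \<le> card (layer B h)"
    if AB: "A \<union> B = pverts G" "A \<noteq> {}" "\<And>b. b \<in> B \<Longrightarrow> \<exists>a \<in> A. \<not> covers G a b"
      and h: "h \<in> U A" for A B h
  proof -
    have dom: "\<exists>b \<in> B. (b, h) \<in> S \<and> covers G b a" if "a \<in> A" for a
    proof -
      have a: "a \<in> pverts G" "h \<in> pverts H"
        using AB h that by (auto simp: U_def)
      \<comment> \<open>As \<open>h\<close> lies in \<open>U A\<close>, the closed neighbourhood of
        \<open>h\<close> carries no element of \<open>S\<close> over \<open>A\<close>; hence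
        domination must come from \<open>B\<close> within the layer.\<close>
      have no: "(a', h') \<notin> S" if "a' \<in> A" "covers H h' h" for a' h'
        using that h S unfolding U_def P_def layer_def dominating_set_cartesian_product by blast
      from S a consider u where "(u, h) \<in> S" "covers G u a" | h' where "(a, h') \<in> S" "(h', h) \<in> parcs H"
        unfolding dominating_set_cartesian_product by blast
      then show ?thesis
      proof cases
        case 1
        have "u \<in> B"
          using 1 no[of u h] S AB(1) unfolding dominating_set_cartesian_product by (auto simp: covers_refl)
        then show ?thesis
          using 1 by blast
      next
        case 2
        then show ?thesis
          using no[OF that] by (auto simp: covers_def)
      qed
    qed
    obtain a where "a \<in> A"
      using AB(2) by blast
    then obtain b where b: "b \<in> B" "(b, h) \<in> S"
      using dom by blast
    then obtain a' where "a' \<in> A" "\<not> covers G b a'"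
      using AB(3) G.covers_sym by blast
    then obtain b' where "b' \<in> B" "(b', h) \<in> S" "b' \<noteq> b"
      using dom by blast
    then have "{(b, h), (b', h)} \<subseteq> layer B h" "card {(b, h), (b', h)} = 2"
      using b by (auto simp: layer_def)
    then show ?thesis
      by (metis card_mono fin_layer)
  qed
  have gamma_le: "\<gamma> H \<le> card (P A) + card (U A)" for A
  proof -
    have "dominating_set H (P A \<union> U A)"
      unfolding dominating_set_iff
    proof (intro conjI ballI)
      show "P A \<union> U A \<subseteq> pverts H"
        by (auto simp: P_def U_def)
      fix h assume "h \<in> pverts H"
      then show "\<exists>u \<in> P A \<union> U A. covers H u h"
        by (cases "h \<in> U A") (auto simp: U_def covers_def)
    qed
    then show ?thesis
      using domination_number_le card_Un_le order_trans by blast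
  qed
  \<comment> \<open>Each \<open>h\<close> is charged once for \<open>P B\<close> and once for
    \<open>U A\<close>. One element of \<open>S\<close> over \<open>B\<close> pays a charge for
    \<open>P B\<close>; by \<open>two\<close>, a layer in \<open>U A\<close> has enough for both
    charges.\<close>
  have count: "card (P B) + card (U A) \<le> card {s \<in> S. fst s \<in> B}"
    if two: "\<And>h. h \<in> U A \<Longrightarrow> 2 \<le> card (layer B h)" for A B
  proof -
    have "card (P B) + card (U A) = (\<Sum>h\<in>pverts H. of_bool (h \<in> P B) + of_bool (h \<in> U A))"
      unfolding sum.distrib using H.pair_finite_verts
      by (simp add: P_def U_def Int_def of_bool_def sum.If_cases)
    also have "\<dots> \<le> (\<Sum>h\<in>pverts H. card (layer B h))"
    proof (rule sum_mono)
      fix h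
      have "h \<in> P B \<Longrightarrow> 1 \<le> card (layer B h)"
        using fin_layer by (simp add: P_def Suc_le_eq card_gt_0_iff)
      then show "of_bool (h \<in> P B) + of_bool (h \<in> U A) \<le> card (layer B h)"
        using two[of h] by (cases "h \<in> U A"; cases "h \<in> P B") auto
    qed
    also have "\<dots> = card (\<Union>h\<in>pverts H. layer B h)"
      using fin_layer H.pair_finite_verts by (intro card_UN_disjoint[symmetric]) (auto simp: layer_def)
    also have "(\<Union>h\<in>pverts H. layer B h) = {s \<in> S. fst s \<in> B}"
      using S by (auto simp: layer_def dominating_set_cartesian_product)
    finally show ?thesis .
  qed
  have "B \<noteq> {}"
    using A part(3) by blast
  have 1: "2 \<le> card (layer B h)" if "h \<in> U A" for h
    using part B that by (intro two[of A B]) auto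
  have 2: "2 \<le> card (layer A h)" if "h \<in> U B" for h
  proof (rule two)
    show "B \<union> A = pverts G"
      using part(1) by blast
    show "\<exists>b \<in> B. \<not> covers G b a" if "a \<in> A" for a
      using A[OF that] G.covers_sym by blast
  qed fact+
  have "2 * \<gamma> H \<le> (card (P B) + card (U A)) + (card (P A) + card (U B))"
    using gamma_le[of A] gamma_le[of B] by simp
  also have "\<dots> \<le> card {s \<in> S. fst s \<in> B} + card {s \<in> S. fst s \<in> A}"
    using 1 2 by (intro add_mono count)
  also have "\<dots> = card ({s \<in> S. fst s \<in> B} \<union> {s \<in> S. fst s \<in> A})"
    using fin part(2) by (intro card_Un_disjoint[symmetric]) auto
  also have "\<dots> \<le> card S"
    using fin by (intro card_mono) auto
  finally show ?thesis
    using card_S by simp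
qed

section \<open>Dominating sets in \<open>P\<^sub>5\<close>-free graphs\<close>

text \<open>Connectedness is reachability in the symmetric closure, which adds no arcs to a
  symmetric graph, so membership in \<open>R\<close> propagates along reachability.\<close>

lemma (in pair_graph) connected_closed_eq:
  assumes conn: "Digraph_Component.connected G" and R: "R \<subseteq> pverts G" "R \<noteq> {}"
    and closed: "\<And>u v. u \<in> R \<Longrightarrow> (u, v) \<in> parcs G \<Longrightarrow> v \<in> R"
  shows "R = pverts G"
proof (rule antisym[OF R(1)], rule subsetI)
  fix v assume v: "v \<in> pverts G"
  obtain u where u: "u \<in> R"
    using R(2) by blast
  have ends: "(x, y) \<in> arcs_ends (mk_symmetric G) \<Longrightarrow> (x, y) \<in> parcs G" for x y
    using arcs_symmetric by (auto simp: mk_symmetric_def)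
  have "u \<rightarrow>\<^sup>*\<^bsub>mk_symmetric G\<^esub> v"
    using conn u v R(1) by (auto simp: Digraph_Component.connected_def strongly_connected_def mk_symmetric_def)
  then have "(u, v) \<in> rtrancl_on (verts (mk_symmetric G)) (arcs_ends (mk_symmetric G))"
    by (simp add: reachable_def)
  then show "v \<in> R"
  proof (induction rule: rtrancl_on_induct)
    case base
    show ?case by (rule u)
  next
    case (step y z)
    show ?case
      using step.IH ends[OF step.hyps(2)] by (rule closed)
  qed
qed

context pair_graph begin

abbreviation adj :: "'a \<Rightarrow> 'a \<Rightarrow> bool" where
  "adj u v \<equiv> (u, v) \<in> parcs G"

text \<open>Distinctness of the five vertices follows from the adjacencies, since no two vertices of
  this path have the same neighbours.\<close>

lemma has_induced_path_5I:
  assumes "adj a b" "adj b c" "adj c d" "adj d e"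
    and "\<not> adj a c" "\<not> adj a d" "\<not> adj a e" "\<not> adj b d" "\<not> adj b e" "\<not> adj c e"
  shows "has_induced G (path_graph 5)"
proof -
  note sym = arcs_symmetric
  have rev: "adj b a" "adj c b" "adj d c" "adj e d"
    "\<not> adj c a" "\<not> adj d a" "\<not> adj e a" "\<not> adj d b" "\<not> adj e b" "\<not> adj e c"
    using assms sym by blast+
  have loop: "\<not> adj x x" for x
    using no_loops' by blast
  have verts: "{a, b, c, d, e} \<subseteq> pverts G"
    using assms in_arcsD1 in_arcsD2 by blast
  have five: "{..<5::nat} = {0, 1, 2, 3, 4}"
    by auto
  interpret P: pair_graph "path_graph 5"
    by (rule pair_graph_path_graph)
  show ?thesis
  proof (rule has_inducedI)
    let ?f = "\<lambda>i. [a, b, c, d, e] ! i"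
    have "distinct [a, b, c, d, e]"
      using assms rev loop by auto
    then show "inj_on ?f (pverts (path_graph 5))"
      by (simp add: path_graph_def inj_on_nth)
    show "?f ` pverts (path_graph 5) \<subseteq> pverts G"
      using verts by (simp add: path_graph_def five)
    fix i j assume ij: "i \<in> pverts (path_graph 5)" "j \<in> pverts (path_graph 5)"
    then have "(i, j) \<in> parcs (path_graph 5) \<longleftrightarrow> j = Suc i \<or> i = Suc j"
      by (simp add: path_graph_def)
    moreover have "i \<in> {0, 1, 2, 3, 4}" "j \<in> {0, 1, 2, 3, 4}"
      using ij by (simp_all add: path_graph_def five)
    ultimately show "adj (?f i) (?f j) \<longleftrightarrow> (i, j) \<in> parcs (path_graph 5)"
      by (elim insertE emptyE) (simp_all add: assms rev loop)
  qed (rule pair_wf_digraph P.pair_wf_digraph)+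
qed

definition nbhd :: "'a set \<Rightarrow> 'a set" where
  "nbhd K = {v \<in> pverts G. \<exists>u \<in> K. covers G u v}"

text \<open>Among all cliques choose \<open>K\<close> dominating the most vertices; among all vertices dominated by \<open>K\<close>
  choose \<open>w\<close> with the most neighbours in the undominated set \<open>Z\<close>. If \<open>Z\<close> is nonempty, then \<open>w\<close> is
  adjacent to all of \<open>Z\<close>, since otherwise \<open>w\<close>, a suitable neighbour \<open>y\<close> and their common neighbours in
  \<open>K\<close> form a clique dominating more. By the choice of \<open>K\<close>, some \<open>x\<close> dominated by \<open>K\<close> is not
  dominated by \<open>w\<close> and its neighbours in \<open>K\<close>, and \<open>{w, v, x}\<close> is dominating for every \<open>v \<in> Z\<close>.\<close>

lemma P5_free_domination:
  assumes conn: "Digraph_Component.connected G" and P5_free: "\<not> has_induced G (path_graph 5)"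
  obtains K where "clique K" "dominating_set G K"
    | w v x where "adj w v" "dominating_set G {w, v, x}"
proof -
  note P5 = has_induced_path_5I[THEN P5_free[THEN notE]]
  have sym: "adj u v \<longleftrightarrow> adj v u" for u v
    using arcs_symmetric by blast
  have fin: "finite (nbhd K)" for K
    by (simp add: nbhd_def pair_finite_verts)
  have "clique {}"
    by (simp add: clique_def)
  moreover have "\<forall>K. clique K \<longrightarrow> card (nbhd K) < Suc (card (pverts G))"
    by (auto simp: less_Suc_eq_le nbhd_def intro: card_mono pair_finite_verts)
  ultimately obtain K where K: "clique K" and max_card: "\<And>K'. clique K' \<Longrightarrow> card (nbhd K') \<le> card (nbhd K)"
    using ex_has_greatest_nat[of clique "{}" "\<lambda>K. card (nbhd K)" "Suc (card (pverts G))"] by blast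
  \<comment> \<open>By the choice of \<open>K\<close>, a clique that dominates something new must
    lose something old.\<close>
  have max: "\<exists>v \<in> nbhd K. v \<notin> nbhd K'" if "clique K'" "z \<in> nbhd K'" "z \<notin> nbhd K" for K' z
  proof (rule ccontr)
    assume "\<not> ?thesis"
    then have "nbhd K \<subseteq> nbhd K'"
      by blast
    then have "nbhd K = nbhd K'"
      using fin max_card[OF that(1)] by (intro card_seteq) auto
    then show False
      using that by simp
  qed
  have K_adj: "adj a b" if "a \<in> K" "b \<in> K" "a \<noteq> b" for a b
    using K that by (auto simp: clique_def covers_def)
  define Z where "Z = pverts G - nbhd K"
  have Z_K: "\<not> adj z a" "\<not> adj a z" if "z \<in> Z" "a \<in> K" for z a
    using that sym by (auto simp: Z_def nbhd_def covers_def)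
  have W_K: "\<exists>a \<in> K. adj w a" if "w \<in> nbhd K" "w \<notin> K" for w
    using that sym by (auto simp: nbhd_def covers_def)
  show thesis
  proof (cases "Z = {}")
    case True
    then have "dominating_set G K"
      using K by (auto simp: Z_def nbhd_def clique_def dominating_set_iff)
    with K show thesis
      by (rule that(1))
  next
    case False
    have not_K: "w \<notin> K" if "z \<in> Z" "adj w z" for w z
      using Z_K that by blast
    \<comment> \<open>Otherwise \<open>insert w K\<close> is a clique that dominates
      \<open>z\<close> and loses nothing.\<close>
    have non_nbr: "\<exists>b \<in> K. \<not> adj w b" if w: "w \<in> nbhd K" and z: "z \<in> Z" "adj w z" for w z
    proof (rule ccontr)
      assume "\<not> ?thesis"
      then have "clique (insert w K)"
        using K w sym by (auto simp: clique_def covers_def nbhd_def)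
      moreover have "z \<in> nbhd (insert w K)" "z \<notin> nbhd K"
        using z by (auto simp: nbhd_def Z_def covers_def)
      ultimately obtain v where "v \<in> nbhd K" "v \<notin> nbhd (insert w K)"
        using max by blast
      then show False
        by (auto simp: nbhd_def)
    qed
    \<comment> \<open>Hence \<open>w\<close> is adjacent to all or none of each component of the
      graph induced on \<open>Z\<close>.\<close>
    have component: "adj w z'" if w: "w \<in> nbhd K" and z: "z \<in> Z" "z' \<in> Z" "adj w z" "adj z z'" for w z z'
    proof (rule ccontr)
      assume no: "\<not> adj w z'"
      obtain a where a: "a \<in> K" "adj w a"
        using W_K w not_K[OF z(1,3)] by blast
      obtain b where b: "b \<in> K" "\<not> adj w b"
        using non_nbr[OF w z(1,3)] by blast
      have "adj a b"
        using K_adj a b by blast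
      then show False
        using P5[of z' z w a b] a b z no by (simp add: Z_K sym)
    qed
    \<comment> \<open>By \<open>component\<close>, the set \<open>?R\<close> is closed under
      adjacency, so connectedness makes it everything.\<close>
    have nbr: "\<exists>w \<in> nbhd K. adj w z" if z: "z \<in> Z" for z
    proof -
      let ?R = "nbhd K \<union> {z \<in> Z. \<exists>w \<in> nbhd K. adj w z}"
      have "nbhd K \<noteq> {}"
      proof
        assume "nbhd K = {}"
        moreover have "clique {z}" "z \<in> nbhd {z}"
          using z by (auto simp: clique_def nbhd_def Z_def)
        ultimately show False
          using max[of "{z}" z] by blast
      qed
      then have "?R = pverts G"
      proof (intro connected_closed_eq[OF conn])
        show "?R \<subseteq> pverts G"
          by (auto simp: nbhd_def Z_def)
        fix u v assume u: "u \<in> ?R" and uv: "adj u v"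
        then have "v \<in> nbhd K \<or> v \<in> Z"
          using in_arcsD2 by (auto simp: Z_def)
        then show "v \<in> ?R"
          using component u uv by blast
      qed blast
      then show ?thesis
        using z by (auto simp: Z_def)
    qed
    \<comment> \<open>Vertices with incomparable neighbourhoods in \<open>Z\<close> are adjacent:
      otherwise they are joined through one or two vertices of \<open>K\<close>, giving an induced
      path from \<open>v\<close> to \<open>z\<close> or from \<open>v\<close> to
      \<open>y\<close>.\<close>
    have crossing: "adj w y"
      if w: "w \<in> nbhd K" "v \<in> Z" "adj w v" "\<not> adj w z" and y: "y \<in> nbhd K" "z \<in> Z" "adj y z" "\<not> adj y v"
      for w v y z
    proof (rule ccontr)
      assume no: "\<not> adj w y"
      have vz: "\<not> adj v z"
        using component w y by blast
      obtain a where a: "a \<in> K" "adj w a"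
        using W_K w not_K by blast
      obtain b where b: "b \<in> K" "adj y b"
        using W_K y not_K by blast
      show False
      proof (cases "adj y a \<or> adj w b")
        case True
        then obtain c where c: "c \<in> K" "adj w c" "adj y c"
          using a b by blast
        then show False
          using P5[of v w c y z] no vz w y by (simp add: Z_K sym)
      next
        case False
        then have "adj a b"
          using K_adj a b by blast
        then show False
          using P5[of v w a b y] no False w y a b by (simp add: Z_K sym)
      qed
    qed
    let ?d = "\<lambda>w. {z \<in> Z. adj w z}"
    have fin_d: "finite (?d w)" for w
      using pair_finite_verts by (simp add: Z_def)
    have "\<exists>w. w \<in> nbhd K"
      using nbr False by blast
    moreover have "\<forall>w. w \<in> nbhd K \<longrightarrow> card (?d w) < Suc (card (pverts G))"
      by (auto simp: less_Suc_eq_le Z_def intro: card_mono pair_finite_verts)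
    ultimately obtain w where w: "w \<in> nbhd K" and max_d: "\<And>y. y \<in> nbhd K \<Longrightarrow> card (?d y) \<le> card (?d w)"
      using ex_has_greatest_nat[of "\<lambda>w. w \<in> nbhd K" _ "\<lambda>w. card (?d w)" "Suc (card (pverts G))"] by blast
    \<comment> \<open>Gaining \<open>z\<close> without losing any neighbour of \<open>w\<close> in
      \<open>Z\<close> would contradict the choice of \<open>w\<close>.\<close>
    have lost: "\<exists>v \<in> Z. adj w v \<and> \<not> adj y v" if y: "y \<in> nbhd K" "z \<in> Z" "adj y z" "\<not> adj w z" for y z
    proof (rule ccontr)
      assume "\<not> ?thesis"
      then have "?d w \<subset> ?d y"
        using y by blast
      then have "card (?d w) < card (?d y)"
        using fin_d by (intro psubset_card_mono)
      then show False
        using max_d[OF y(1)] by simp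
    qed
    have w_Z: "adj w z" if z: "z \<in> Z" for z
    proof (rule ccontr)
      assume wz: "\<not> adj w z"
      obtain y where y: "y \<in> nbhd K" "adj y z"
        using nbr z by blast
      obtain v where v: "v \<in> Z" "adj w v" "\<not> adj y v"
        using lost y z wz by blast
      have wy: "adj w y"
        using crossing w v y z wz by blast
      have vz: "\<not> adj v z"
        using component w v z wz by blast
      let ?K = "{w, y} \<union> {a \<in> K. adj w a \<and> adj y a}"
      have "clique ?K"
        using w y wy sym K K_adj by (auto simp: clique_def covers_def nbhd_def)
      moreover have "z \<in> nbhd ?K" "z \<notin> nbhd K"
        using z y by (auto simp: nbhd_def Z_def covers_def)
      ultimately obtain x where x: "x \<in> nbhd K" "x \<notin> nbhd ?K"
        using max by blast
      have xV: "x \<in> pverts G"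
        using x(1) by (simp add: nbhd_def)
      have xw: "\<not> adj x w" "\<not> adj x y" "x \<noteq> w" "x \<noteq> y"
        and xC: "\<And>a. a \<in> K \<Longrightarrow> adj w a \<Longrightarrow> adj y a \<Longrightarrow> \<not> adj x a \<and> x \<noteq> a"
        using x(2) xV sym by (auto simp: nbhd_def covers_def)
      \<comment> \<open>If \<open>x\<close> saw \<open>z\<close>, then \<open>w\<close> and
        \<open>x\<close> would have incomparable neighbourhoods in \<open>Z\<close> and be adjacent
        by \<open>crossing\<close>.\<close>
      have xz: "\<not> adj x z"
      proof
        assume "adj x z"
        then obtain v' where "v' \<in> Z" "adj w v'" "\<not> adj x v'"
          using lost x z wz by blast
        then show False
          using crossing[of w v' z x] w x z wz xw sym \<open>adj x z\<close> by blast
      qed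
      obtain a where a: "a \<in> K" "adj w a"
        using W_K w v not_K by blast
      have "x \<notin> K"
      proof
        assume "x \<in> K"
        then have "adj a x"
          using K_adj a xw sym by blast
        moreover have "\<not> adj y a"
          using xC a calculation sym by blast
        ultimately show False
          using P5[of z y w a x] y wy wz a z xw xz by (simp add: Z_K sym)
      qed
      then obtain b where b: "b \<in> K" "adj x b"
        using W_K x by blast
      consider "\<not> adj w b" "\<not> adj y b" | "adj w b" "\<not> adj y b" | "\<not> adj w b" "adj y b"
        using xC b by blast
      then show False
      proof cases
        case 1
        have ab: "adj a b"
          using K_adj a b 1 by blast
        show False
        proof (cases "adj y a")
          case True
          then show False
            using P5[of z y a b x] ab 1 y a b z xw xz xC by (simp add: Z_K sym)
        next
          case False
          then show False
            using P5[of z y w a b] ab 1 y wy wz a b z by (simp add: Z_K sym)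
        qed
      next
        case 2
        then show False
          using P5[of z y w b x] y wy wz b z xw xz by (simp add: Z_K sym)
      next
        case 3
        show False
        proof (cases "adj x v")
          case True
          then show False
            using P5[of x v w y z] v vz wy wz y xw xz by (simp add: sym)
        next
          case False
          then show False
            using P5[of v w y b x] 3 v wy b xw by (simp add: Z_K sym)
        qed
      qed
    qed
    obtain v where v: "v \<in> Z"
      using False by blast
    let ?K = "insert w {a \<in> K. adj w a}"
    have wv: "adj w v"
      using w_Z v by blast
    obtain a where a: "a \<in> K" "adj w a"
      using W_K w v wv not_K by blast
    \<comment> \<open>A vertex lost on passing from \<open>K\<close> to \<open>?K\<close> is
      adjacent to \<open>v\<close>; otherwise it ends an induced path starting with \<open>v\<close>
      and \<open>w\<close> and passing through two vertices of \<open>K\<close>.\<close>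
    have escape: "adj x v" if x: "x \<in> nbhd K" "x \<notin> nbhd ?K" for x
    proof (rule ccontr)
      assume xv: "\<not> adj x v"
      have "x \<in> pverts G"
        using x(1) by (simp add: nbhd_def)
      then have xw: "\<not> adj x w" and xC: "\<And>a. a \<in> K \<Longrightarrow> adj w a \<Longrightarrow> \<not> adj x a \<and> x \<noteq> a"
        using x(2) sym by (auto simp: nbhd_def covers_def)
      have "x \<notin> K"
        using xC[OF a] K_adj a by blast
      then obtain b where b: "b \<in> K" "adj x b"
        using W_K x by blast
      have wb: "\<not> adj w b"
        using xC b by blast
      then have "adj a b"
        using K_adj a b by blast
      then show False
        using P5[of v w a b x] xv xw xC[OF a] a b wb wv v by (simp add: Z_K sym)
    qed
    have "clique ?K"
      using w K K_adj sym by (auto simp: clique_def covers_def nbhd_def)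
    moreover have "v \<in> nbhd ?K" "v \<notin> nbhd K"
      using v wv by (auto simp: nbhd_def Z_def covers_def)
    ultimately obtain x where x: "x \<in> nbhd K" "x \<notin> nbhd ?K"
      using max by blast
    have xV: "x \<in> pverts G" "w \<in> pverts G" "v \<in> pverts G"
      using x(1) w v by (auto simp: nbhd_def Z_def)
    have xv: "adj x v"
      using escape x by blast
    have xw: "\<not> adj x w" and xC: "\<And>a. a \<in> K \<Longrightarrow> adj w a \<Longrightarrow> \<not> adj x a"
      using x(2) xV sym by (auto simp: nbhd_def covers_def)
    \<comment> \<open>An uncovered \<open>y\<close> is not in \<open>Z\<close>, as \<open>w\<close>
      sees all of \<open>Z\<close>, and by \<open>escape\<close> it is still dominated by
      \<open>?K\<close>. A common neighbour \<open>c\<close> of \<open>y\<close> and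
      \<open>w\<close> in \<open>K\<close> yields the induced path \<open>y\<close>,
      \<open>c\<close>, \<open>w\<close>, \<open>v\<close>, \<open>x\<close>.\<close>
    have "\<exists>u \<in> {w, v, x}. covers G u y" if y: "y \<in> pverts G" for y
    proof (rule ccontr)
      assume no: "\<not> ?thesis"
      then have y_no: "\<not> adj y w" "\<not> adj y v" "\<not> adj y x" "y \<noteq> w"
        using sym by (auto simp: covers_def)
      have "y \<in> nbhd K"
        using y y_no w_Z sym by (auto simp: Z_def)
      then have "y \<in> nbhd ?K"
        using escape y_no by blast
      then obtain c where c: "c \<in> K" "adj w c" "adj c y"
        using y_no sym by (auto simp: nbhd_def covers_def)
      then show False
        using P5[of y c w v x] y_no xC[of c] xv xw wv v by (simp add: Z_K sym)
    qed
    then have "dominating_set G {w, v, x}"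
      using xV by (simp add: dominating_set_iff)
    with wv show thesis
      by (rule that(2))
  qed
qed

end

section \<open>The two bounds\<close>

context pair_graph begin

section \<open>Clique and degree bounds from forbidden subgraphs\<close>

lemma has_induced_complete_graphI:
  assumes "clique K" "n \<le> card K"
  shows "has_induced G (complete_graph n)"
proof -
  have "finite K"
    using assms(1) pair_finite_verts by (auto simp: clique_def intro: finite_subset)
  then obtain f where f: "f ` {..<n} \<subseteq> K" "inj_on f {..<n}"
    using card_le_inj[of "{..<n}" K] assms(2) by auto
  have "pair_wf_digraph (complete_graph n)"
    by unfold_locales (auto simp: complete_graph_def)
  then show ?thesis
  proof (rule has_inducedI[OF pair_wf_digraph])
    show "inj_on f (pverts (complete_graph n))" "f ` pverts (complete_graph n) \<subseteq> pverts G"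
      using f assms(1) by (auto simp: complete_graph_def clique_def)
    fix i j assume ij: "i \<in> pverts (complete_graph n)" "j \<in> pverts (complete_graph n)"
    then have "f i \<in> K" "f j \<in> K" "f i = f j \<longleftrightarrow> i = j"
      using f by (auto simp: complete_graph_def inj_on_eq_iff)
    then have "adj (f i) (f j) \<longleftrightarrow> i \<noteq> j"
      using assms(1) no_loops'[of "f i" "f j"] unfolding clique_def covers_def by blast
    then show "adj (f i) (f j) \<longleftrightarrow> (i, j) \<in> parcs (complete_graph n)"
      using ij by (simp add: complete_graph_def)
  qed
qed

text \<open>Adjacent neighbours of \<open>v\<close> would form a triangle with it, so
  \<open>v\<close> together with any \<open>r\<close> neighbours would induce a star.\<close>

lemma degree_less:
  assumes K3: "\<not> has_induced G (complete_graph 3)" and star: "\<not> has_induced G (star_graph r)"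
    and v: "v \<in> pverts G"
  shows "card {u. adj v u} < r"
proof (rule ccontr)
  let ?N = "{u. adj v u}"
  assume "\<not> ?thesis"
  then have "card {1..r} \<le> card ?N"
    by simp
  moreover have fin: "finite ?N"
    by (rule finite_subset[OF _ pair_finite_verts]) (auto dest: in_arcsD2)
  ultimately obtain f where f: "f ` {1..r} \<subseteq> ?N" "inj_on f {1..r}"
    using card_le_inj[of "{1..r}" ?N] by auto
  let ?f = "\<lambda>i. if i = 0 then v else f i"
  have nbr: "adj v (f i)" "adj (f i) v" "v \<noteq> f i" if "i \<in> {1..r}" for i
    using f(1) that arcs_symmetric no_loops' by blast+
  have indep: "\<not> adj (f i) (f j)" if "i \<in> {1..r}" "j \<in> {1..r}" for i j
  proof
    assume *: "adj (f i) (f j)"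
    then have "f i \<noteq> f j"
      using no_loops' by blast
    then have "card {v, f i, f j} = 3"
      using nbr[OF that(1)] nbr[OF that(2)] by simp
    moreover have "clique {v, f i, f j}"
      using * nbr[OF that(1)] nbr[OF that(2)] arcs_symmetric[OF *] v in_arcsD2
      unfolding clique_def covers_def by blast
    ultimately show False
      using has_induced_complete_graphI[of "{v, f i, f j}" 3] K3 by simp
  qed
  have "pair_wf_digraph (star_graph r)"
    by unfold_locales (auto simp: star_graph_def)
  then have "has_induced G (star_graph r)"
  proof (rule has_inducedI[OF pair_wf_digraph])
    have leaf: "i \<in> {1..r}" if "i \<in> pverts (star_graph r)" "i \<noteq> 0" for i
      using that by (simp add: star_graph_def)
    show "inj_on ?f (pverts (star_graph r))"
    proof (rule inj_onI)
      fix i j assume i: "i \<in> pverts (star_graph r)" and j: "j \<in> pverts (star_graph r)" and eq: "?f i = ?f j"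
      show "i = j"
        using eq nbr(3)[OF leaf[OF i]] nbr(3)[OF leaf[OF j]] inj_onD[OF f(2) _ leaf[OF i] leaf[OF j]]
        by (cases "i = 0"; cases "j = 0") auto
    qed
    show "?f ` pverts (star_graph r) \<subseteq> pverts G"
    proof (rule image_subsetI)
      fix i assume "i \<in> pverts (star_graph r)"
      then show "?f i \<in> pverts G"
        using v in_arcsD2[OF nbr(1)[OF leaf]] by simp
    qed
    fix i j assume i: "i \<in> pverts (star_graph r)" and j: "j \<in> pverts (star_graph r)"
    then have "(i, j) \<in> parcs (star_graph r) \<longleftrightarrow> (i = 0 \<longleftrightarrow> j \<noteq> 0)"
      by (auto simp: star_graph_def)
    then show "adj (?f i) (?f j) \<longleftrightarrow> (i, j) \<in> parcs (star_graph r)"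
      using nbr(2)[OF leaf[OF i]] nbr(1)[OF leaf[OF j]] indep[OF leaf[OF i] leaf[OF j]] no_loops'[of v v]
      by (cases "i = 0"; cases "j = 0") auto
  qed
  with star show False ..
qed

end

lemma allegiance_bound_real:
  fixes G :: "'a pair_pre_digraph" and H :: "'b pair_pre_digraph"
  assumes "pair_graph G" "pair_graph H" "dominating_set G D" "card D = \<gamma> G"
    and "\<And>v. v \<in> pverts G \<Longrightarrow> card {u \<in> D. covers G u v} \<le> p" and "0 < p"
  shows "real p / (2 * real p - 1) * real (\<gamma> G) * real (\<gamma> H) \<le> real (\<gamma> (G \<box> H))"
proof -
  obtain q where p: "p = Suc q"
    using \<open>0 < p\<close> gr0_implies_Suc by blast
  have "Suc q * (\<gamma> G * \<gamma> H) \<le> (2 * q + 1) * \<gamma> (G \<box> H)"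
    using assms(1-5) unfolding p by (rule allegiance_bound)
  then have "real (Suc q) * (real (\<gamma> G) * real (\<gamma> H)) \<le> (2 * real q + 1) * real (\<gamma> (G \<box> H))"
    by (metis (mono_tags, opaque_lifting) of_nat_1 of_nat_add of_nat_le_iff of_nat_mult of_nat_numeral)
  then show ?thesis
    by (simp add: p divide_simps ac_simps)
qed

theorem corollary2p5:
  fixes r :: nat and G :: "'a pair_pre_digraph"
  assumes "1 < r" and "pair_graph G" and "Digraph_Component.connected G"
  shows "(\<not> has_induced G (complete_graph 3) \<and> \<not> has_induced G (star_graph r) \<longrightarrow>
      (\<forall>H :: 'b pair_pre_digraph. pair_graph H \<and> Digraph_Component.connected H \<longrightarrow>
        real (\<gamma> (G \<box> H)) \<ge> real r / (2 * real r - 1) * real (\<gamma> G) * real (\<gamma> H))) \<and>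
    (\<not> has_induced G (complete_graph r) \<and> \<not> has_induced G (path_graph 5) \<longrightarrow>
      (\<forall>H :: 'b pair_pre_digraph. pair_graph H \<and> Digraph_Component.connected H \<longrightarrow>
        real (\<gamma> (G \<box> H)) \<ge> (real r - 1) / (2 * real r - 3) * real (\<gamma> G) * real (\<gamma> H)))"
proof (intro conjI impI allI)
  interpret pair_graph G by fact
  obtain D where D: "dominating_set G D" "card D = \<gamma> G"
    by (rule obtain_minimum_dominating_set)
  have fin_D: "finite D"
    using assms(2) D(1) by (rule finite_dominating_set)
  {
    fix H :: "'b pair_pre_digraph"
    assume free: "\<not> has_induced G (complete_graph 3) \<and> \<not> has_induced G (star_graph r)"
      and H: "pair_graph H \<and> Digraph_Component.connected H"
    have "card {u \<in> D. covers G u v} \<le> r" if v: "v \<in> pverts G" for v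
    proof -
      have fin: "finite {u. adj v u}"
        by (rule finite_subset[OF _ pair_finite_verts]) (auto dest: in_arcsD2)
      then have "card {u \<in> D. covers G u v} \<le> card (insert v {u. adj v u})"
        using arcs_symmetric by (intro card_mono) (auto simp: covers_def)
      also have "\<dots> \<le> Suc (card {u. adj v u})"
        using fin by (simp add: card_insert_if)
      also have "\<dots> \<le> r"
        using degree_less[OF _ _ v] free by (simp add: Suc_leI)
      finally show ?thesis .
    qed
    then show "real r / (2 * real r - 1) * real (\<gamma> G) * real (\<gamma> H) \<le> real (\<gamma> (G \<box> H))"
      using assms(1,2) D H by (intro allegiance_bound_real) auto
  next
    fix H :: "'b pair_pre_digraph"
    assume free: "\<not> has_induced G (complete_graph r) \<and> \<not> has_induced G (path_graph 5)"
      and H: "pair_graph H \<and> Digraph_Component.connected H"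
    have small: "card K < r" if "clique K" for K
      using has_induced_complete_graphI[OF that, of r] free by fastforce
    \<comment> \<open>A dominating clique has fewer than \<open>r\<close> vertices. A dominating
      triple contains an edge, which forces \<open>r\<close> to be at least 3; the bound 3 exceeds
      \<open>r - 1\<close> only for \<open>r = 3\<close>.\<close>
    have "\<gamma> G \<le> r - 1 \<or> r = 3 \<and> \<gamma> G = 3"
    proof (rule P5_free_domination[OF assms(3)])
      fix K assume "clique K" "dominating_set G K"
      then show ?thesis
        using small[of K] domination_number_le[of G K] by fastforce
    next
      fix w v x assume adj: "adj w v" and dom: "dominating_set G {w, v, x}"
      have "clique {w, v}"
        using adj arcs_symmetric in_arcsD1 in_arcsD2 by (auto simp: clique_def covers_def)
      then have "2 < r"
        using small[of "{w, v}"] no_loops'[OF adj] by simp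
      moreover have "\<gamma> G \<le> 3"
        using domination_number_le[OF dom] card_insert_le_m1[of 3 "{v, x}" w] card_insert_le_m1[of 2 "{x}" v] by simp
      ultimately show ?thesis
        by linarith
    qed (use free in blast)
    then show "(real r - 1) / (2 * real r - 3) * real (\<gamma> G) * real (\<gamma> H) \<le> real (\<gamma> (G \<box> H))"
    proof
      assume le: "\<gamma> G \<le> r - 1"
      \<comment> \<open>The whole of \<open>D\<close> has at most \<open>r - 1\<close>
        elements.\<close>
      have "card {u \<in> D. covers G u v} \<le> r - 1" for v
        using card_mono[OF fin_D, of "{u \<in> D. covers G u v}"] D(2) le by auto
      then have "real (r - 1) / (2 * real (r - 1) - 1) * real (\<gamma> G) * real (\<gamma> H) \<le> real (\<gamma> (G \<box> H))"
        using assms(1,2) D H by (intro allegiance_bound_real) auto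
      then show ?thesis
        using assms(1) by (simp add: of_nat_diff)
    next
      \<comment> \<open>Here the constant is 2/3, and 2/3 times \<open>\<gamma> G = 3\<close> is
        exactly the factor 2.\<close>
      assume 3: "r = 3 \<and> \<gamma> G = 3"
      then have "2 * \<gamma> H \<le> \<gamma> (G \<box> H)"
        using assms(2) H by (intro domination_number_product_ge_twice) auto
      then show ?thesis
        using 3 by simp
    qed
  }
qed

end
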